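(* Let $\mathcal{H}=\mathcal{H}_{\mathfrak l}\otimes\mathcal{H}_{\mathfrak w}\otimes\mathcal{H}_{\mathfrak e}$ be finite-dimensional with Hamiltonian $H_\kappa = H+\kappa\,\mathbb{1}_{\mathfrak l}\otimes H_u\otimes\mathbb{1}_{\mathfrak e}$, where $\kappa\in\mathbb{R}$, and let $\rho(t)=e^{-\mathrm{i}H_\kappa t}\rho_0e^{\mathrm{i}H_\kappa t}$ with initial density matrix $\rho_0$. Let $|\psi_i^\kappa\rangle$ be an orthonormal eigenbasis of $H_\kappa$ with eigenvalues $\lambda_i^\kappa$, and set $\lambda_{abij}=\lambda_a^\kappa-\lambda_b^\kappa+\lambda_i^\kappa-\lambda_j^\kappa$, $\rho_{ij}=\langle\psi_i^\kappa|\rho_0|\psi_j^\kappa\rangle$, $\tau_{ij}=\mathrm{tr}_{\mathfrak{we}}(|\psi_i^\kappa\rangle\langle\psi_j^\kappa|)$, $\mathcal{C}_1=\{(a,b,i,j):\lambda_{abij}\neq0\}$, with complement $\bar{\mathcal{C}}_1$, and $$\bar\gamma=\sum_{(a,b,i,j)\in\bar{\mathcal{C}}_1}\rho_{ab}\rho_{ij}\,\mathrm{tr}(\tau_{ab}\tau_{ij}),\qquad \vec\rho=\big[\rho_{ab}\rho_{ij}\,\mathrm{tr}(\tau_{ab}\tau_{ij})\big]_{(a,b,i,j)\in\mathcal{C}_1}.$$ Then the purity $\gamma_{\mathfrak l}(\rho(t))=\mathrm{tr}\big((\mathrm{tr}_{\mathfrak{we}}\rho(t))^2\big)$ satisfies,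 for all $t\in\mathbb{R}$, $$\gamma_{\mathfrak l}(\rho(t))\ \ge\ \bar\gamma-\|\vec\rho\|_1 .$$
   Context: $H$ and $H_u$ are Hermitian; $\mathrm{tr}_{\mathfrak{we}}$ is the partial trace over $\mathcal{H}_{\mathfrak w}\otimes\mathcal{H}_{\mathfrak e}$; $\|\cdot\|_1$ is the $\ell^1$ norm (sum of absolute values of entries). With these definitions the purity can be written $\gamma_{\mathfrak l}(\rho(t))=\bar\gamma+\sum_{(a,b,i,j)\in\mathcal{C}_1}e^{-\mathrm{i}\lambda_{abij}t}\rho_{ab}\rho_{ij}\mathrm{tr}(\tau_{ab}\tau_{ij})$. *)

theory Defs
  imports "HOL-Analysis.Analysis"
begin

text \<open>
  A finite-dimensional Hilbert space with a fixed orthonormal product basis is rendered as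
  \<^typ>\<open>complex ^ 'n\<close>; its dimension is the cardinality of the index type \<^typ>\<open>'n::finite\<close>.
  The tensor product of the spaces over \<^typ>\<open>'a\<close> and \<^typ>\<open>'b\<close> is the space over the product
  index type \<^typ>\<open>'a \<times> 'b\<close>.
\<close>

definition braket :: "complex ^ 'n \<Rightarrow> complex ^ 'n \<Rightarrow> complex" where
  "braket x y = (\<Sum>i\<in>UNIV. cnj (x $ i) * y $ i)"

definition ketbra :: "complex ^ 'n \<Rightarrow> complex ^ 'n \<Rightarrow> complex ^ 'n ^ 'n" where
  "ketbra x y = (\<chi> i j. x $ i * cnj (y $ j))"

definition ctranspose :: "complex ^ 'n ^ 'm \<Rightarrow> complex ^ 'm ^ 'n" where
  "ctranspose A = (\<chi> i j. cnj (A $ j $ i))"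

definition hermitian :: "complex ^ 'n ^ 'n \<Rightarrow> bool" where
  "hermitian A \<longleftrightarrow> ctranspose A = A"

definition density_matrix :: "complex ^ 'n ^ 'n \<Rightarrow> bool" where
  "density_matrix A \<longleftrightarrow>
     hermitian A \<and> (\<forall>x. 0 \<le> Re (braket x (A *v x))) \<and> trace A = 1"

definition cscale :: "complex \<Rightarrow> complex ^ 'n ^ 'm \<Rightarrow> complex ^ 'n ^ 'm" where
  "cscale c A = (\<chi> i j. c * A $ i $ j)"

definition kron :: "complex ^ 'b ^ 'a \<Rightarrow> complex ^ 'd ^ 'c \<Rightarrow> complex ^ ('b \<times> 'd) ^ ('a \<times> 'c)"
  where "kron A B = (\<chi> p q. A $ fst p $ fst q * B $ snd p $ snd q)"

text \<open>Partial trace over the second tensor factor.\<close>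

definition ptrace_snd ::
  "complex ^ ('a::finite \<times> 'b::finite) ^ ('a \<times> 'b) \<Rightarrow> complex ^ 'a ^ 'a" where
  "ptrace_snd A = (\<chi> i j. \<Sum>k\<in>UNIV. A $ (i, k) $ (j, k))"

text \<open>
  Matrix exponential as a power series. The type class operations \<open>*\<close> and \<open>^\<close> act
  componentwise on vectors, so powers are iterated from the matrix product \<open>**\<close>.
\<close>

definition mexp :: "complex ^ 'n ^ 'n \<Rightarrow> complex ^ 'n ^ 'n" where
  "mexp A = (\<Sum>k. (1 / fact k) *\<^sub>R (((**) A ^^ k) (mat 1)))"

definition evolve :: "complex ^ 'n ^ 'n \<Rightarrow> complex ^ 'n ^ 'n \<Rightarrow> real \<Rightarrow> complex ^ 'n ^ 'n" where
  "evolve H \<rho>0 t =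
     mexp (cscale (- (\<i> * of_real t)) H) ** \<rho>0 ** mexp (cscale (\<i> * of_real t) H)"

text \<open>
  The index type \<^typ>\<open>'k\<close> only enumerates the basis; the conditions force its cardinality to be
  that of \<^typ>\<open>'n\<close>. Eigenvalues may be taken real because the operator will be Hermitian.
\<close>

definition orthonormal_eigenbasis ::
  "complex ^ 'n ^ 'n \<Rightarrow> ('k::finite \<Rightarrow> complex ^ 'n) \<Rightarrow> ('k \<Rightarrow> real) \<Rightarrow> bool" where
  "orthonormal_eigenbasis H \<psi> ev \<longleftrightarrow>
     (\<forall>i j. braket (\<psi> i) (\<psi> j) = (if i = j then 1 else 0)) \<and>
     vec.span (range \<psi>) = UNIV \<and>
     (\<forall>i. H *v \<psi> i = of_real (ev i) *s \<psi> i)"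

text \<open>
  In what follows the three factors are indexed by \<^typ>\<open>'l\<close>, \<^typ>\<open>'w\<close> and \<^typ>\<open>'e\<close>; as products
  of types associate to the right, \<open>ptrace_snd\<close> traces out the last two factors together.
\<close>

definition controlled_hamiltonian ::
  "complex ^ ('l::finite \<times> 'w::finite \<times> 'e::finite) ^ ('l \<times> 'w \<times> 'e) \<Rightarrow>
   complex ^ 'w ^ 'w \<Rightarrow> real \<Rightarrow> complex ^ ('l \<times> 'w \<times> 'e) ^ ('l \<times> 'w \<times> 'e)" where
  "controlled_hamiltonian H Hu \<kappa> = H + \<kappa> *\<^sub>R kron (mat 1) (kron Hu (mat 1))"

definition purity_l ::
  "complex ^ ('l::finite \<times> 'w::finite \<times> 'e::finite) ^ ('l \<times> 'w \<times> 'e) \<Rightarrow> complex" where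
  "purity_l \<rho> = trace (ptrace_snd \<rho> ** ptrace_snd \<rho>)"

definition tau ::
  "('k \<Rightarrow> complex ^ ('l::finite \<times> 'w::finite \<times> 'e::finite)) \<Rightarrow> 'k \<Rightarrow> 'k \<Rightarrow> complex ^ 'l ^ 'l" where
  "tau \<psi> i j = ptrace_snd (ketbra (\<psi> i) (\<psi> j))"

definition matrix_element ::
  "('k \<Rightarrow> complex ^ 'n) \<Rightarrow> complex ^ 'n ^ 'n \<Rightarrow> 'k \<Rightarrow> 'k \<Rightarrow> complex" where
  "matrix_element \<psi> \<rho> i j = braket (\<psi> i) (\<rho> *v \<psi> j)"

definition eigenvalue_gap :: "('k \<Rightarrow> real) \<Rightarrow> 'k \<times> 'k \<times> 'k \<times> 'k \<Rightarrow> real" where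
  "eigenvalue_gap ev = (\<lambda>(a, b, i, j). ev a - ev b + ev i - ev j)"

definition C1 :: "('k \<Rightarrow> real) \<Rightarrow> ('k \<times> 'k \<times> 'k \<times> 'k) set" where
  "C1 ev = {x. eigenvalue_gap ev x \<noteq> 0}"

definition rho_vec ::
  "('k \<Rightarrow> complex ^ ('l::finite \<times> 'w::finite \<times> 'e::finite)) \<Rightarrow>
   complex ^ ('l \<times> 'w \<times> 'e) ^ ('l \<times> 'w \<times> 'e) \<Rightarrow> 'k \<times> 'k \<times> 'k \<times> 'k \<Rightarrow> complex" where
  "rho_vec \<psi> \<rho>0 = (\<lambda>(a, b, i, j).
     matrix_element \<psi> \<rho>0 a b * matrix_element \<psi> \<rho>0 i j * trace (tau \<psi> a b ** tau \<psi> i j))"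

definition gamma_bar ::
  "('k::finite \<Rightarrow> complex ^ ('l::finite \<times> 'w::finite \<times> 'e::finite)) \<Rightarrow> ('k \<Rightarrow> real) \<Rightarrow>
   complex ^ ('l \<times> 'w \<times> 'e) ^ ('l \<times> 'w \<times> 'e) \<Rightarrow> complex" where
  "gamma_bar \<psi> ev \<rho>0 = (\<Sum>x\<in>- C1 ev. rho_vec \<psi> \<rho>0 x)"

definition l1_norm_on :: "'i set \<Rightarrow> ('i \<Rightarrow> complex) \<Rightarrow> real" where
  "l1_norm_on I v = (\<Sum>x\<in>I. cmod (v x))"

end

theory Submission
  imports Defs
begin

text \<open>
  Since the projections \<open>|\<psi>\<^sub>i\<rangle>\<langle>\<psi>\<^sub>i|\<close> sum to the identity, the exponential series diagonalises and
  \<open>\<rho>(t)\<close> is the sum of \<open>\<rho>\<^sub>a\<^sub>b |\<psi>\<^sub>a\<rangle>\<langle>\<psi>\<^sub>b|\<close> with phases \<open>exp (- \<i> (\<lambda>\<^sub>a - \<lambda>\<^sub>b) t)\<close>. Expanding the square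
  in the purity gives the sum of \<open>exp (- \<i> \<lambda>\<^sub>a\<^sub>b\<^sub>i\<^sub>j t)\<close> times the entries of \<open>rho_vec\<close>; the resonant
  terms make up \<open>gamma_bar\<close>, and each other term has real part at least minus its modulus.
  Reality follows from the involution \<open>(a, b, i, j) \<mapsto> (b, a, j, i)\<close>, which conjugates every term.
\<close>

lemma sum_matrix_mult: "(\<Sum>i\<in>S. A i) ** B = (\<Sum>i\<in>S. A i ** B)"
  for B :: "'a::semiring_1 ^ 'n ^ 'm"
  by (simp add: vec_eq_iff matrix_matrix_mult_def sum_component sum_distrib_right sum.swap[of _ S])

lemma matrix_mult_sum: "B ** (\<Sum>i\<in>S. A i) = (\<Sum>i\<in>S. B ** A i)"
  for B :: "'a::semiring_1 ^ 'n ^ 'm"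
  by (simp add: vec_eq_iff matrix_matrix_mult_def sum_component sum_distrib_left sum.swap[of _ S])

lemma sum_matrix_vector_mult: "(\<Sum>i\<in>S. A i) *v x = (\<Sum>i\<in>S. A i *v x)"
  for x :: "'a::semiring_1 ^ 'n"
  by (simp add: vec_eq_iff matrix_vector_mult_def sum_component sum_distrib_right sum.swap[of _ S])

lemma trace_sum: "trace (\<Sum>i\<in>S. A i) = (\<Sum>i\<in>S. trace (A i))"
  for A :: "_ \<Rightarrow> 'a::comm_semiring_1 ^ 'n ^ 'n"
  by (simp add: trace_def sum_component sum.swap[of _ S])

lemma ptrace_snd_sum: "ptrace_snd (\<Sum>i\<in>S. A i) = (\<Sum>i\<in>S. ptrace_snd (A i))"
  by (simp add: vec_eq_iff ptrace_snd_def sum_component sum.swap[of _ S])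

lemma ptrace_snd_cscale: "ptrace_snd (cscale c A) = cscale c (ptrace_snd A)"
  by (simp add: vec_eq_iff ptrace_snd_def cscale_def sum_distrib_left)

lemma trace_cscale: "trace (cscale c A) = c * trace A"
  by (simp add: trace_def cscale_def sum_distrib_left)

lemma cscale_cscale: "cscale c (cscale d A) = cscale (c * d) A"
  by (simp add: vec_eq_iff cscale_def mult.assoc)

lemma cscale_sum: "cscale c (\<Sum>i\<in>S. A i) = (\<Sum>i\<in>S. cscale c (A i))"
  by (simp add: vec_eq_iff cscale_def sum_component sum_distrib_left)

lemma cscale_mult: "cscale c A ** B = cscale c (A ** B)"
  by (simp add: vec_eq_iff cscale_def matrix_matrix_mult_def sum_distrib_left mult.assoc)

lemma mult_cscale: "A ** cscale c B = cscale c (A ** B)"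
  by (simp add: vec_eq_iff cscale_def matrix_matrix_mult_def sum_distrib_left mult.left_commute)

text \<open>Lets a convergent scalar power series be pushed into a matrix coefficient; boundedness
  comes from the finite dimension of \<open>complex\<close>.\<close>

lemma bounded_linear_cscale: "bounded_linear (\<lambda>c. cscale c A)"
  for A :: "complex ^ 'n ^ 'm"
proof -
  have "linear (\<lambda>c. cscale c A)"
    by (rule linearI) (simp_all add: vec_eq_iff cscale_def algebra_simps)
  then show ?thesis
    by (rule linear_conv_bounded_linear[THEN iffD1])
qed

lemma ketbra_mult_vec: "ketbra x y *v z = braket y z *s x"
  by (simp add: vec_eq_iff ketbra_def braket_def matrix_vector_mult_def sum_distrib_left
      sum_distrib_right algebra_simps)

lemma mult_ketbra: "A ** ketbra x y = ketbra (A *v x) y"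
  by (simp add: vec_eq_iff ketbra_def matrix_matrix_mult_def matrix_vector_mult_def
      sum_distrib_right mult.assoc)

lemma ketbra_scale_left: "ketbra (c *s x) y = cscale c (ketbra x y)"
  by (simp add: vec_eq_iff ketbra_def cscale_def mult.assoc)

text \<open>Rank-one factors on both sides leave only one scalar of \<open>A\<close>; on basis
  vectors this scalar is a \<open>matrix_element\<close>.\<close>

lemma ketbra_sandwich:
  "ketbra x x ** A ** ketbra y y = cscale (braket x (A *v y)) (ketbra x y)"
  by (simp add: mult_ketbra ketbra_mult_vec ketbra_scale_left flip: matrix_vector_mul_assoc)

text \<open>By orthonormality the sum fixes every basis vector; its fixed points form a subspace, so
  the spanning condition makes it fix everything.\<close>

lemma eigenbasis_resolution:
  assumes "orthonormal_eigenbasis K \<psi> ev"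
  shows "(\<Sum>i\<in>UNIV. ketbra (\<psi> i) (\<psi> i)) = mat 1"
proof -
  define P where "P = (\<Sum>i\<in>UNIV. ketbra (\<psi> i) (\<psi> i))"
  have orth: "braket (\<psi> i) (\<psi> j) = (if i = j then 1 else 0)" for i j
    using assms by (simp add: orthonormal_eigenbasis_def)
  have "P *v \<psi> j = \<psi> j" for j
  proof -
    have "P *v \<psi> j = (\<Sum>i\<in>UNIV. if i = j then \<psi> i else 0)"
      unfolding P_def sum_matrix_vector_mult
      by (rule sum.cong) (simp_all add: ketbra_mult_vec orth)
    then show ?thesis by simp
  qed
  moreover have "x \<in> vec.span (range \<psi>)" for x
    using assms by (simp add: orthonormal_eigenbasis_def)
  moreover have "vec.subspace {x. P *v x = x}"
    by (auto simp: vec.subspace_def matrix_vector_right_distrib matrix_vector_mult_scaleR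
        vector_scalar_commute)
  ultimately have "P *v x = x" for x
    using vec.span_minimal[of "range \<psi>" "{x. P *v x = x}"] by blast
  then show ?thesis
    by (simp add: matrix_eq flip: P_def)
qed

lemma mexp_eigenbasis:
  fixes K :: "complex ^ 'n ^ 'n"
  assumes "orthonormal_eigenbasis K \<psi> ev"
  shows "mexp (cscale c K) =
    (\<Sum>i\<in>UNIV. cscale (exp (c * of_real (ev i))) (ketbra (\<psi> i) (\<psi> i)))"
proof -
  let ?P = "\<lambda>i. ketbra (\<psi> i) (\<psi> i)"
  have eig: "K *v \<psi> i = of_real (ev i) *s \<psi> i" for i
    using assms by (simp add: orthonormal_eigenbasis_def)
  \<comment> \<open>The zeroth power \<open>mat 1\<close> is itself resolved into projections, and
    each further factor multiplies the \<open>i\<close>-th one by its eigenvalue.\<close>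
  have pow: "((**) (cscale c K) ^^ k) (mat 1) = (\<Sum>i\<in>UNIV. cscale ((c * of_real (ev i)) ^ k) (?P i))"
    for k
  proof (induction k)
    case 0
    then show ?case
      by (simp add: eigenbasis_resolution[OF assms, symmetric] cscale_def vec_eq_iff)
  next
    case (Suc k)
    then show ?case
      by (simp add: matrix_mult_sum cscale_mult mult_cscale mult_ketbra eig ketbra_scale_left
          cscale_cscale cscale_sum mult_ac)
  qed
  \<comment> \<open>The matrix series thus splits into finitely many scalar exponential series, one
    per projection.\<close>
  have "(\<lambda>k. \<Sum>i\<in>UNIV. cscale ((c * of_real (ev i)) ^ k /\<^sub>R fact k) (?P i)) sums
    (\<Sum>i\<in>UNIV. cscale (exp (c * of_real (ev i))) (?P i))"
    by (rule sums_sum) (rule bounded_linear.sums[OF bounded_linear_cscale exp_converges])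
  moreover have "(1 / fact k) *\<^sub>R ((**) (cscale c K) ^^ k) (mat 1) =
    (\<Sum>i\<in>UNIV. cscale ((c * of_real (ev i)) ^ k /\<^sub>R fact k) (?P i))" for k
    unfolding pow by (simp add: vec_eq_iff cscale_def sum_component scaleR_sum_right divide_inverse)
  ultimately show ?thesis
    unfolding mexp_def by (simp add: sums_iff)
qed

lemma evolve_eigenbasis:
  fixes K :: "complex ^ 'n ^ 'n"
  assumes "orthonormal_eigenbasis K \<psi> ev"
  shows "evolve K \<rho> t = (\<Sum>(a, b)\<in>UNIV. cscale
    (exp (- \<i> * of_real ((ev a - ev b) * t)) * matrix_element \<psi> \<rho> a b) (ketbra (\<psi> a) (\<psi> b)))"
proof -
  let ?u = "\<lambda>c a. exp (c * of_real (ev a))"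
  let ?P = "\<lambda>a. ketbra (\<psi> a) (\<psi> a)"
  \<comment> \<open>This nesting, with the factor from the right exponential outermost, is what
    \<open>cscale_cscale\<close> produces below; \<open>z\<close> stands for the matrix
    element.\<close>
  have phase: "?u (\<i> * of_real t) b * (?u (- (\<i> * of_real t)) a * z) =
      exp (- \<i> * of_real ((ev a - ev b) * t)) * z" for a b z
    by (simp add: mult.assoc[symmetric] mult_exp_exp) (simp add: algebra_simps)
  have "evolve K \<rho> t = (\<Sum>a\<in>UNIV. \<Sum>b\<in>UNIV. cscale (?u (\<i> * of_real t) b)
      (cscale (?u (- (\<i> * of_real t)) a) (?P a ** \<rho> ** ?P b)))"
    \<comment> \<open>Expanding the left exponential first makes \<open>a\<close> the outer
      summation index and \<open>b\<close> the inner one.\<close>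
    by (simp only: evolve_def mexp_eigenbasis[OF assms] sum_matrix_mult)
      (simp only: matrix_mult_sum sum_matrix_mult cscale_mult mult_cscale cscale_sum)
  also have "\<dots> = (\<Sum>a\<in>UNIV. \<Sum>b\<in>UNIV. cscale
      (exp (- \<i> * of_real ((ev a - ev b) * t)) * matrix_element \<psi> \<rho> a b) (ketbra (\<psi> a) (\<psi> b)))"
    by (simp only: ketbra_sandwich cscale_cscale phase matrix_element_def)
  finally show ?thesis
    by (simp only: sum.cartesian_product UNIV_Times_UNIV)
qed

text \<open>The partial trace is linear, so squaring yields a double sum over index pairs, and the
  two phases of a term multiply to that of the combined gap.\<close>

lemma purity_l_evolve:
  assumes "orthonormal_eigenbasis K \<psi> ev"
  shows "purity_l (evolve K \<rho> t) =
    (\<Sum>x\<in>UNIV. exp (- \<i> * of_real (eigenvalue_gap ev x * t)) * rho_vec \<psi> \<rho> x)"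
proof -
  define c where "c p = exp (- \<i> * of_real ((ev (fst p) - ev (snd p)) * t))
    * matrix_element \<psi> \<rho> (fst p) (snd p)" for p
  define T where "T p = tau \<psi> (fst p) (snd p)" for p
  have "ptrace_snd (evolve K \<rho> t) = (\<Sum>p\<in>UNIV. cscale (c p) (T p))"
    by (simp add: evolve_eigenbasis[OF assms] ptrace_snd_sum ptrace_snd_cscale tau_def
        case_prod_unfold c_def T_def)
  then have "purity_l (evolve K \<rho> t) =
      trace (\<Sum>p\<in>UNIV. \<Sum>q\<in>UNIV. cscale (c p) (T p) ** cscale (c q) (T q))"
    by (simp only: purity_l_def sum_matrix_mult) (simp only: matrix_mult_sum)
  also have "\<dots> = (\<Sum>(p, q)\<in>UNIV. c p * c q * trace (T p ** T q))"
    by (simp only: trace_sum cscale_mult mult_cscale cscale_cscale trace_cscale mult.commute)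
      (simp only: sum.cartesian_product UNIV_Times_UNIV)
  also have "\<dots> = (\<Sum>x\<in>UNIV. exp (- \<i> * of_real (eigenvalue_gap ev x * t)) * rho_vec \<psi> \<rho> x)"
    \<comment> \<open>Pairs of pairs are regrouped into the right-nested quadruples that index
      \<open>rho_vec\<close>.\<close>
    by (rule sum.reindex_bij_witness[of _ "\<lambda>(a, b, i, j). ((a, b), (i, j))"
          "\<lambda>((a, b), (i, j)). (a, b, i, j)"])
      (auto simp: c_def T_def rho_vec_def eigenvalue_gap_def exp_add[symmetric] algebra_simps)
  finally show ?thesis .
qed

lemma cnj_matrix_element:
  assumes "hermitian \<rho>"
  shows "cnj (matrix_element \<psi> \<rho> i j) = matrix_element \<psi> \<rho> j i"
proof -
  have entry: "cnj (\<rho> $ k $ l) = \<rho> $ l $ k" for k l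
    using assms by (auto simp: hermitian_def ctranspose_def vec_eq_iff)
  show ?thesis
    unfolding matrix_element_def braket_def matrix_vector_mult_def
    by (simp add: sum_distrib_left entry, subst sum.swap) (simp add: mult_ac)
qed

lemma ctranspose_tau: "ctranspose (tau \<psi> a b) = tau \<psi> b a"
  by (simp add: vec_eq_iff ctranspose_def tau_def ptrace_snd_def ketbra_def mult.commute)

lemma cnj_trace: "cnj (trace A) = trace (ctranspose A)"
  by (simp add: trace_def ctranspose_def)

lemma ctranspose_mult: "ctranspose (A ** B) = ctranspose B ** ctranspose A"
  by (simp add: vec_eq_iff ctranspose_def matrix_matrix_mult_def mult.commute)

definition flip_index :: "'k \<times> 'k \<times> 'k \<times> 'k \<Rightarrow> 'k \<times> 'k \<times> 'k \<times> 'k" where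
  "flip_index = (\<lambda>(a, b, i, j). (b, a, j, i))"

lemma flip_index_flip_index [simp]: "flip_index (flip_index x) = x"
  by (simp add: flip_index_def case_prod_unfold)

text \<open>The sign change conjugates each phase and maps the complement of \<open>C1 ev\<close>,
  where the gap vanishes, to itself.\<close>

lemma eigenvalue_gap_flip_index: "eigenvalue_gap ev (flip_index x) = - eigenvalue_gap ev x"
  by (simp add: flip_index_def eigenvalue_gap_def case_prod_unfold)

text \<open>Hermiticity conjugates the matrix elements. Taking the adjoint swaps the indices of each
  \<open>tau\<close> and reverses their product; cyclicity of the trace restores the order.\<close>

lemma rho_vec_flip_index:
  assumes "hermitian \<rho>"
  shows "rho_vec \<psi> \<rho> (flip_index x) = cnj (rho_vec \<psi> \<rho> x)"
proof (cases x)
  case (fields a b i j)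
  have "cnj (trace (tau \<psi> a b ** tau \<psi> i j)) = trace (tau \<psi> b a ** tau \<psi> j i)"
    unfolding cnj_trace ctranspose_mult ctranspose_tau by (rule trace_mul_sym)
  then show ?thesis
    by (simp add: fields rho_vec_def flip_index_def cnj_matrix_element[OF assms])
qed

text \<open>Reindexing by the involution turns the sum into its own conjugate.\<close>

lemma sum_flip_index_in_Reals:
  assumes "\<And>x. x \<in> S \<Longrightarrow> flip_index x \<in> S" and "\<And>x. x \<in> S \<Longrightarrow> f (flip_index x) = cnj (f x)"
  shows "sum f S \<in> \<real>"
proof -
  have "sum f S = (\<Sum>x\<in>S. cnj (f x))"
    by (rule sum.reindex_bij_witness[of _ flip_index flip_index]) (use assms in auto)
  then show ?thesis
    by (simp add: Reals_cnj_iff)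
qed

text \<open>\<open>purity_l\<close> and \<open>gamma_bar\<close> are complex by type; the two
  reality claims make the bound on real parts a bound on the quantities themselves.\<close>

theorem proposition5:
  fixes H :: "complex ^ ('l::finite \<times> 'w::finite \<times> 'e::finite) ^ ('l \<times> 'w \<times> 'e)"
    and Hu :: "complex ^ 'w ^ 'w"
    and \<rho>0 :: "complex ^ ('l \<times> 'w \<times> 'e) ^ ('l \<times> 'w \<times> 'e)"
    and \<kappa> :: real
    and \<psi> :: "'k::finite \<Rightarrow> complex ^ ('l \<times> 'w \<times> 'e)"
    and ev :: "'k \<Rightarrow> real"
  assumes "hermitian H" and "hermitian Hu"
    and "density_matrix \<rho>0"
    and "orthonormal_eigenbasis (controlled_hamiltonian H Hu \<kappa>) \<psi> ev"
  shows "\<forall>t::real.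
      purity_l (evolve (controlled_hamiltonian H Hu \<kappa>) \<rho>0 t) \<in> \<real> \<and>
      gamma_bar \<psi> ev \<rho>0 \<in> \<real> \<and>
      Re (purity_l (evolve (controlled_hamiltonian H Hu \<kappa>) \<rho>0 t))
        \<ge> Re (gamma_bar \<psi> ev \<rho>0) - l1_norm_on (C1 ev) (rho_vec \<psi> \<rho>0)"
proof (intro allI conjI)
  fix t :: real
  let ?K = "controlled_hamiltonian H Hu \<kappa>"
  let ?f = "\<lambda>x. exp (- \<i> * of_real (eigenvalue_gap ev x * t)) * rho_vec \<psi> \<rho>0 x"
  have herm: "hermitian \<rho>0"
    using assms(3) by (simp add: density_matrix_def)
  have purity: "purity_l (evolve ?K \<rho>0 t) = sum ?f UNIV"
    by (rule purity_l_evolve[OF assms(4)])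
  show "purity_l (evolve ?K \<rho>0 t) \<in> \<real>"
    unfolding purity
    by (rule sum_flip_index_in_Reals)
      (simp_all add: eigenvalue_gap_flip_index rho_vec_flip_index[OF herm] exp_cnj)
  show "gamma_bar \<psi> ev \<rho>0 \<in> \<real>"
    unfolding gamma_bar_def
    by (rule sum_flip_index_in_Reals)
      (simp_all add: C1_def eigenvalue_gap_flip_index rho_vec_flip_index[OF herm])
  have "purity_l (evolve ?K \<rho>0 t) = sum ?f (- C1 ev) + sum ?f (C1 ev)"
    unfolding purity by (subst sum.union_disjoint[symmetric]) auto
  \<comment> \<open>Off \<open>C1 ev\<close> the gap is zero, so every phase equals 1.\<close>
  also have "sum ?f (- C1 ev) = gamma_bar \<psi> ev \<rho>0"
    unfolding gamma_bar_def by (rule sum.cong) (auto simp: C1_def)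
  finally have "Re (purity_l (evolve ?K \<rho>0 t)) = Re (gamma_bar \<psi> ev \<rho>0) + Re (sum ?f (C1 ev))"
    by simp
  moreover have "\<bar>Re (sum ?f (C1 ev))\<bar> \<le> (\<Sum>x\<in>C1 ev. cmod (?f x))"
    using abs_Re_le_cmod norm_sum order_trans by blast
  \<comment> \<open>The gap and \<open>t\<close> are real, so the phase has modulus 1 and the bound
    does not depend on \<open>t\<close>.\<close>
  moreover have "cmod (?f x) = cmod (rho_vec \<psi> \<rho>0 x)" for x
    by (simp add: norm_mult)
  ultimately show "Re (gamma_bar \<psi> ev \<rho>0) - l1_norm_on (C1 ev) (rho_vec \<psi> \<rho>0)
      \<le> Re (purity_l (evolve ?K \<rho>0 t))"
    by (simp add: l1_norm_on_def)
qed

end
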